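(* Let $n\ge 2$ be an integer, let $m\le M$ be real numbers and let $x_1,\dots,x_n$ be real numbers, not all equal, with $m\le x_i\le M$ for $i=1,\dots,n$. Let $\overline{x}=\frac1n\sum_{i=1}^n x_i$ and $m_r=\frac1n\sum_{i=1}^n (x_i-\overline{x})^r$ for $r=2,4$. Then $$m\le \overline{x}-\left(\frac{n^2-3n+3}{(n-1)^3}\,\frac{m_2^4}{m_4}\right)^{1/4}\quad\text{and}\quad M\ge \overline{x}+\left(\frac{n^2-3n+3}{(n-1)^3}\,\frac{m_2^4}{m_4}\right)^{1/4}.$$
   Context: $m_r$ (with a subscript) denotes the $r$-th central moment of $x_1,\dots,x_n$; $m$ (without subscript) is a lower bound for the $x_i$. *)

theory Defs
  imports Complex_Main
begin

definition sample_mean :: "nat \<Rightarrow> (nat \<Rightarrow> real) \<Rightarrow> real" where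
  "sample_mean n x = (1 / real n) * (\<Sum>i = 1..n. x i)"

definition central_moment :: "nat \<Rightarrow> (nat \<Rightarrow> real) \<Rightarrow> nat \<Rightarrow> real" where
  "central_moment n x r = (1 / real n) * (\<Sum>i = 1..n. (x i - sample_mean n x) ^ r)"

end

theory Submission
  imports Defs
begin

text \<open>After centring and rescaling, let \<open>y\<close> have mean \<open>0\<close> and \<open>y \<le> 1\<close>, and write \<open>s\<close>, \<open>m\<^sub>3\<close>, \<open>m\<^sub>4\<close>
  for its second, third and fourth moments. As \<open>-(n - 1) \<le> y \<le> 1\<close>, averaging
  \<open>(1 - y) (y + n - 1) \<ge> 0\<close> gives \<open>s \<le> n - 1\<close>. Averaging \<open>(1 - y) (y + s)\<^sup>2 \<ge> 0\<close> gives
  \<open>m\<^sub>3 \<le> s (1 - s)\<close>, and averaging \<open>(y\<^sup>2 - (1 - s) y - s)\<^sup>2 \<ge> 0\<close> then yields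
  \<open>m\<^sub>4 \<ge> s\<^sup>3 - s\<^sup>2 + s\<close> if \<open>s \<ge> 1\<close>. Since \<open>u - u\<^sup>2 + u\<^sup>3\<close> increases in \<open>u = 1 / s\<close>, the ratio
  \<open>m\<^sub>4 / s\<^sup>4\<close> is at least its value at \<open>s = n - 1\<close>, which is \<open>(n\<^sup>2 - 3 n + 3) / (n - 1)\<^sup>3\<close>.
  If \<open>s < 1\<close>, then \<open>m\<^sub>4 \<ge> s\<^sup>2 \<ge> s\<^sup>4\<close> suffices. The lower bound follows by reflection.\<close>

text \<open>The difference has the factor \<open>v - u\<close>; its cofactor is half of a sum of
  squares. It is applied to the reciprocals \<open>1/k\<close> and \<open>1/s\<close>, and to
  \<open>1/k\<close> and \<open>1\<close>.\<close>

lemma cubic_mono: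
  fixes u v :: real
  assumes "u \<le> v"
  shows "u - u^2 + u^3 \<le> v - v^2 + v^3"
proof -
  have "1 - (u + v) + (u^2 + u * v + v^2) = ((u + v - 1)^2 + u^2 + v^2 + 1) / 2"
    by (simp add: power2_eq_square field_simps)
  also have "\<dots> \<ge> 0"
    by simp
  finally have "0 \<le> 1 - (u + v) + (u^2 + u * v + v^2)" .
  then have "0 \<le> (v - u) * (1 - (u + v) + (u^2 + u * v + v^2))"
    using assms by simp
  then show ?thesis
    by (simp add: power2_eq_square power3_eq_cube algebra_simps)
qed

lemma kurtosis_bound_le_1:
  fixes y :: "'a \<Rightarrow> real"
  assumes fin: "finite A" and n: "card A = n" "n \<ge> 2"
    and sum0: "(\<Sum>i\<in>A. y i) = 0" and le1: "\<And>i. i \<in> A \<Longrightarrow> y i \<le> 1"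
    and s: "s = (\<Sum>i\<in>A. y i ^ 2) / n" and q: "q = (\<Sum>i\<in>A. y i ^ 4) / n"
  shows "((real n)^2 - 3 * real n + 3) / (real n - 1)^3 * s^4 \<le> q"
proof -
  define N where "N = real n"
  define k where "k = N - 1"
  define t where "t = (\<Sum>i\<in>A. y i ^ 3) / N"
  have N: "N \<ge> 2" "N > 0" and k: "k \<ge> 1"
    using n by (auto simp: N_def k_def)
  have S: "(\<Sum>i\<in>A. y i ^ 2) = N * s" "(\<Sum>i\<in>A. y i ^ 3) = N * t" "(\<Sum>i\<in>A. y i ^ 4) = N * q"
    "real (card A) = N"
    using N n by (simp_all add: s q t_def N_def)
  \<comment> \<open>The other \<open>k\<close> values sum to \<open>- y i\<close>, and each is at
    most \<open>1\<close>.\<close>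
  have lower: "- k \<le> y i" if "i \<in> A" for i
  proof -
    have "(\<Sum>j\<in>A - {i}. y j) \<le> (\<Sum>j\<in>A - {i}. 1)"
      by (rule sum_mono) (use le1 in auto)
    also have "\<dots> = k"
      using fin n that by (simp add: k_def N_def card_Diff_singleton of_nat_diff)
    finally show ?thesis
      using sum.remove[OF fin that, of y] sum0 by simp
  qed
  have "0 \<le> (\<Sum>i\<in>A. (1 - y i) * (y i + k))"
    by (rule sum_nonneg) (use lower le1 in \<open>fastforce intro!: mult_nonneg_nonneg\<close>)
  also have "\<dots> = (\<Sum>i\<in>A. k + (1 - k) * y i - y i ^ 2)"
    by (rule sum.cong) (simp_all add: algebra_simps power2_eq_square)
  also have "\<dots> = N * (k - s)"
    using S sum0 by (simp add: sum.distrib sum_subtractf algebra_simps flip: sum_distrib_left)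
  finally have sk: "s \<le> k"
    using N by (simp add: zero_le_mult_iff)
  \<comment> \<open>The double root \<open>-s\<close> comes from the extremal case: a mean-zero
    distribution on the two values \<open>1\<close> and \<open>-s\<close> has variance exactly
    \<open>s\<close>.\<close>
  have "0 \<le> (\<Sum>i\<in>A. (1 - y i) * (y i + s)^2)"
    by (rule sum_nonneg) (use le1 in auto)
  also have "\<dots> = (\<Sum>i\<in>A. s^2 + (2 * s - s^2) * y i + (1 - 2 * s) * y i ^ 2 - y i ^ 3)"
    by (rule sum.cong) (simp_all add: algebra_simps power2_eq_square power3_eq_cube)
  also have "\<dots> = N * (s^2 + (1 - 2 * s) * s - t)"
    using S sum0 by (simp add: sum.distrib sum_subtractf flip: sum_distrib_left)
      (simp add: algebra_simps)
  finally have "0 \<le> s^2 + (1 - 2 * s) * s - t"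
    using N by (simp add: zero_le_mult_iff)
  then have t: "t \<le> s * (1 - s)"
    by (simp add: algebra_simps power2_eq_square)
  \<comment> \<open>Two values of \<open>a\<close> are used: for \<open>a = 1 - s\<close> the
    quadratic is \<open>(y - 1) * (y + s)\<close>, vanishing at the extremal values, while
    \<open>a = 0\<close> gives \<open>s^2 \<le> q\<close>.\<close>
  have quad: "2 * a * t - a^2 * s + s^2 \<le> q" for a
  proof -
    have "0 \<le> (\<Sum>i\<in>A. (y i ^ 2 - a * y i - s)^2)"
      by (rule sum_nonneg) auto
    also have "\<dots> = (\<Sum>i\<in>A. s^2 + (2 * a * s) * y i + (a^2 - 2 * s) * y i ^ 2
                     - (2 * a) * y i ^ 3 + y i ^ 4)"
      by (rule sum.cong)
        (simp_all add: algebra_simps power2_eq_square power3_eq_cube power4_eq_xxxx)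
    also have "\<dots> = N * (s^2 + (a^2 - 2 * s) * s - 2 * a * t + q)"
      using S sum0 by (simp add: sum.distrib sum_subtractf flip: sum_distrib_left)
        (simp add: algebra_simps)
    finally have "0 \<le> s^2 + (a^2 - 2 * s) * s - 2 * a * t + q"
      using N by (simp add: zero_le_mult_iff)
    then show ?thesis
      by (simp add: algebra_simps power2_eq_square)
  qed
  have s0: "0 \<le> s"
    unfolding s by (simp add: sum_nonneg)
  have c: "((real n)^2 - 3 * real n + 3) / (real n - 1)^3 = 1/k - (1/k)^2 + (1/k)^3" (is "?c = _")
  proof -
    have "(real n)^2 - 3 * real n + 3 = k^2 - k + 1" "real n - 1 = k"
      by (simp_all add: k_def N_def power2_eq_square algebra_simps)
    then show ?thesis
      using k by (simp add: field_simps power2_eq_square power3_eq_cube)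
  qed
  show ?thesis
  proof (cases "s \<ge> 1")
    case True
    have "?c \<le> 1/s - (1/s)^2 + (1/s)^3"
      unfolding c by (rule cubic_mono) (use sk True in \<open>simp add: frac_le\<close>)
    then have "?c * s^4 \<le> (1/s - (1/s)^2 + (1/s)^3) * s^4"
      by (rule mult_right_mono) simp
    also have "\<dots> = s^3 - s^2 + s"
      using True by (simp add: field_simps power2_eq_square power3_eq_cube power4_eq_xxxx)
    also have "\<dots> \<le> q"
    proof -
      \<comment> \<open>As \<open>1 - s \<le> 0\<close>, the upper bound on \<open>t\<close> becomes
        a lower bound on the term linear in \<open>t\<close>.\<close>
      have "(1 - s) * t \<ge> (1 - s) * (s * (1 - s))"
        using True t by (intro mult_left_mono_neg) auto
      with quad[of "1 - s"] show ?thesis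
        by (simp add: algebra_simps power2_eq_square power3_eq_cube)
    qed
    finally show ?thesis .
  next
    case False
    have "?c \<le> 1"
      using cubic_mono[of "1/k" 1] k unfolding c by simp
    then have "?c * s^4 \<le> 1 * s^4"
      by (rule mult_right_mono) simp
    also have "\<dots> \<le> s^2"
      using False s0 by (simp add: power_decreasing)
    also have "\<dots> \<le> q"
      using quad[of 0] by simp
    finally show ?thesis .
  qed
qed

text \<open>By homogeneity, dividing by \<open>b > 0\<close> reduces this to the bound
  \<open>1\<close>: \<open>s\<close> scales with degree 2 and \<open>q\<close> with degree 4, so
  \<open>s^4 / q\<close> has degree 4.\<close>

lemma kurtosis_bound:
  fixes y :: "'a \<Rightarrow> real"
  assumes fin: "finite A" and n: "card A = n" "n \<ge> 2"
    and sum0: "(\<Sum>i\<in>A. y i) = 0" and le: "\<And>i. i \<in> A \<Longrightarrow> y i \<le> b"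
    and nz: "\<exists>i\<in>A. y i \<noteq> 0"
    and s: "s = (\<Sum>i\<in>A. y i ^ 2) / n" and q: "q = (\<Sum>i\<in>A. y i ^ 4) / n"
  shows "(((real n)^2 - 3 * real n + 3) / (real n - 1)^3 * (s^4 / q)) powr (1/4) \<le> b"
    (is "(?c * _) powr _ \<le> _")
proof -
  have b: "b > 0"
  proof (rule ccontr)
    assume "\<not> b > 0"
    then have "\<forall>i\<in>A. 0 \<le> - y i"
      using le by fastforce
    moreover have "(\<Sum>i\<in>A. - y i) = 0"
      using sum0 by (simp add: sum_negf)
    ultimately show False
      using nz fin sum_nonneg_eq_0_iff[of A "\<lambda>i. - y i"] by auto
  qed
  have "(\<Sum>i\<in>A. y i ^ 4) > 0"
    using nz fin by (auto intro: sum_pos2)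
  then have q0: "q > 0"
    using n by (simp add: q)
  have "?c * (s / b^2)^4 \<le> q / b^4"
    by (rule kurtosis_bound_le_1[of A n "\<lambda>i. y i / b"])
      (use fin n sum0 le b in \<open>auto simp: s q power_divide simp flip: sum_divide_distrib\<close>)
  then have "?c * (s / b^2)^4 * (b^8 / q) \<le> q / b^4 * (b^8 / q)"
    by (rule mult_right_mono) (use q0 b in simp)
  moreover have "q / b^4 * (b^8 / q) = b^4"
    using b q0 by (simp flip: power_diff)
  moreover have "(s / b^2)^4 * (b^8 / q) = s^4 / q"
    using b by (simp add: power_divide flip: power_mult)
  ultimately have "?c * (s^4 / q) \<le> b^4"
    by (simp only: mult.assoc)
  \<comment> \<open>Completing the square shows the base to be nonnegative, as monotonicity of
    \<open>powr\<close> requires.\<close>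
  moreover have "(real n)^2 - 3 * real n + 3 = (real n - 3/2)^2 + 3/4"
    by (simp add: power2_eq_square algebra_simps)
  then have "0 \<le> ?c * (s^4 / q)"
    using q0 n by (intro mult_nonneg_nonneg divide_nonneg_nonneg) auto
  ultimately have "(?c * (s^4 / q)) powr (1/4) \<le> (b^4) powr (1/4)"
    by (intro powr_mono2) auto
  also have "\<dots> = b"
    using b powr_powr[of b 4 "1/4"] by simp
  finally show ?thesis .
qed

theorem corollary2p9:
  fixes n :: nat and m M :: real and x :: "nat \<Rightarrow> real"
  assumes "n \<ge> 2"
    and "m \<le> M"
    and "\<exists>i \<in> {1..n}. \<exists>j \<in> {1..n}. x i \<noteq> x j"
    and "\<forall>i \<in> {1..n}. m \<le> x i \<and> x i \<le> M"
  shows "m \<le> sample_mean n x -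
             (((real n)^2 - 3 * real n + 3) / (real n - 1)^3 *
              ((central_moment n x 2)^4 / central_moment n x 4)) powr (1/4)
       \<and> M \<ge> sample_mean n x +
             (((real n)^2 - 3 * real n + 3) / (real n - 1)^3 *
              ((central_moment n x 2)^4 / central_moment n x 4)) powr (1/4)"
    (is "m \<le> _ - ?K \<and> _")
proof -
  let ?\<mu> = "sample_mean n x"
  have sum0: "(\<Sum>i=1..n. x i - ?\<mu>) = 0"
    using assms(1) by (simp add: sum_subtractf sample_mean_def)
  have nz: "\<exists>i\<in>{1..n}. x i - ?\<mu> \<noteq> 0"
    using assms(3) by (metis eq_iff_diff_eq_0)
  have "?K \<le> M - ?\<mu>"
    by (rule kurtosis_bound[of "{1..n}" n "\<lambda>i. x i - ?\<mu>"])
      (use assms(1,4) sum0 nz in \<open>auto simp: central_moment_def\<close>)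
  \<comment> \<open>The deviations with opposite sign are bounded by \<open>?\<mu> - m\<close> and
    have the same even moments.\<close>
  moreover have "?K \<le> ?\<mu> - m"
  proof (rule kurtosis_bound[of "{1..n}" n "\<lambda>i. ?\<mu> - x i"])
    show "(\<Sum>i\<in>{1..n}. ?\<mu> - x i) = 0"
      using sum0 by (simp add: sum_subtractf)
    show "\<exists>i\<in>{1..n}. ?\<mu> - x i \<noteq> 0"
      using nz by force
    show "central_moment n x 2 = (\<Sum>i\<in>{1..n}. (?\<mu> - x i)^2) / n"
      by (simp add: central_moment_def power2_commute)
    show "central_moment n x 4 = (\<Sum>i\<in>{1..n}. (?\<mu> - x i)^4) / n"
    proof -
      have "(x i - ?\<mu>)^4 = (?\<mu> - x i)^4" for i
        using power_minus_Bit0[of "?\<mu> - x i" "num.Bit0 num.One"] by simp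
      then show ?thesis
        by (simp add: central_moment_def)
    qed
  qed (use assms in auto)
  ultimately show ?thesis
    by simp
qed

end
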